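(* For every finite set of formulas $T\subseteq\mathcal{L}_{\Box\Diamond}$ and every formula $\varphi\in\mathcal{L}_{\Box\Diamond}$: $T\models_{\Pi\mathcal{G}}\varphi$ if and only if $T\vdash_{K45(\mathbf{G})}\varphi$.
   Context: Language. Fix a countable set $Var$ of propositional variables. $\mathcal{L}_{\Box\Diamond}$ is the set of formulas built from $Var$ and the constant $\bot$ with the binary connectives $\wedge,\to$ and the unary operators $\Box,\Diamond$. Abbreviations: $\top := \bot\to\bot$, $\neg\varphi := \varphi\to\bot$, $\varphi\vee\psi := ((\varphi\to\psi)\to\psi)\wedge((\psi\to\varphi)\to\varphi)$. Calculus. Gödel propositional logic $G$ has modus ponens as its rule and the axiom schemes: $(\varphi\to\psi)\to((\psi\to\chi)\to(\varphi\to\chi))$; $(\varphi\wedge\psi)\to\varphi$; $(\varphi\wedge\psi)\to(\psi\wedge\varphi)$; $(\varphi\to(\psi\to\chi))\to((\varphi\wedge\psi)\to\chi)$; $((\varphi\wedge\psi)\to\chi)\to(\varphi\to(\psi\to\chi))$; $\varphi\to(\varphi\wedge\varphi)$; $((\varphi\to\psi)\to\chi)\to(((\psi\to\varphi)\to\chi)\to\chi)$; $\bot\to\varphi$. The logic $K(\mathbf{G})$ consists of $G$ over the modal language together with the axiom schemes $\Box(\varphi\to\psi)\to(\Box\varphi\to\Box\psi)$; $\Diamond(\varphi\vee\psi)\to(\Diamond\varphi\vee\Diamond\psi)$; $\Box\top$; $\neg\Diamond\bot$; $\Box(\varphi\to\psi)\to(\Diamond\varphi\to\Diamond\psi)$;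 $(\Diamond\varphi\to\Box\psi)\to\Box(\varphi\to\psi)$; and the rule (Nec): from $\varphi$ infer $\Box\varphi$. The logic $K45(\mathbf{G})$ is $K(\mathbf{G})$ plus the axiom schemes $\Box\varphi\to\Box\Box\varphi$; $\Diamond\Diamond\varphi\to\Diamond\varphi$; $\Diamond\Box\varphi\to\Box\varphi$; $\Diamond\varphi\to\Box\Diamond\varphi$. $T\vdash_{K45(\mathbf{G})}\varphi$ means that $\varphi$ is derivable from assumptions $T$ and the axioms by modus ponens and (Nec), where (Nec) may be applied only when its premise is a theorem (derivable without assumptions). Semantics. On $[0,1]$ let $x\Rightarrow y = 1$ if $x\le y$ and $x\Rightarrow y=y$ otherwise. A possibilistic Gödel Kripke model ($\Pi G$-model) is a triple $\langle W,\pi,e\rangle$ with $W$ a non-empty set, $\pi:W\to[0,1]$ and $e:W\times Var\to[0,1]$ arbitrary maps. $e$ is extended to all formulas by $e(w,\bot)=0$, $e(w,\varphi\wedge\psi)=\min(e(w,\varphi),e(w,\psi))$, $e(w,\varphi\to\psi)=e(w,\varphi)\Rightarrow e(w,\psi)$, $e(w,\Box\varphi)=\inf_{w'\in W}\{\pi(w')\Rightarrow e(w',\varphi)\}$, $e(w,\Diamond\varphi)=\sup_{w'\in W}\{\min(\pi(w'),e(w',\varphi))\}$. $T\models_{\Pi\mathcal{G}}\varphi$ means: for every $\Pi G$-model $\langle W,\pi,e\rangle$ and every $w\in W$, if $e(w,\psi)=1$ for all $\psi\in T$ then $e(w,\varphi)=1$. *)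

theory Defs
  imports Complex_Main "HOL-Library.Countable"
begin

datatype 'v fm =
    Atom 'v
  | Bot
  | And "'v fm" "'v fm"
  | Imp "'v fm" "'v fm"
  | Box "'v fm"
  | Dia "'v fm"

abbreviation Top :: "'v fm" where
  "Top \<equiv> Imp Bot Bot"

abbreviation Neg :: "'v fm \<Rightarrow> 'v fm" where
  "Neg \<phi> \<equiv> Imp \<phi> Bot"

abbreviation Or :: "'v fm \<Rightarrow> 'v fm \<Rightarrow> 'v fm" where
  "Or \<phi> \<psi> \<equiv> And (Imp (Imp \<phi> \<psi>) \<psi>) (Imp (Imp \<psi> \<phi>) \<phi>)"

inductive G_axiom :: "'v fm \<Rightarrow> bool" where
  G1: "G_axiom (Imp (Imp \<phi> \<psi>) (Imp (Imp \<psi> \<chi>) (Imp \<phi> \<chi>)))"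
| G2: "G_axiom (Imp (And \<phi> \<psi>) \<phi>)"
| G3: "G_axiom (Imp (And \<phi> \<psi>) (And \<psi> \<phi>))"
| G4: "G_axiom (Imp (Imp \<phi> (Imp \<psi> \<chi>)) (Imp (And \<phi> \<psi>) \<chi>))"
| G5: "G_axiom (Imp (Imp (And \<phi> \<psi>) \<chi>) (Imp \<phi> (Imp \<psi> \<chi>)))"
| G6: "G_axiom (Imp \<phi> (And \<phi> \<phi>))"
| G7: "G_axiom (Imp (Imp (Imp \<phi> \<psi>) \<chi>) (Imp (Imp (Imp \<psi> \<phi>) \<chi>) \<chi>))"
| G8: "G_axiom (Imp Bot \<phi>)"

inductive KG_axiom :: "'v fm \<Rightarrow> bool" where
  KG_G: "G_axiom \<phi> \<Longrightarrow> KG_axiom \<phi>"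
| K_Box: "KG_axiom (Imp (Box (Imp \<phi> \<psi>)) (Imp (Box \<phi>) (Box \<psi>)))"
| K_Dia: "KG_axiom (Imp (Dia (Or \<phi> \<psi>)) (Or (Dia \<phi>) (Dia \<psi>)))"
| F_Box: "KG_axiom (Box Top)"
| F_Dia: "KG_axiom (Neg (Dia Bot))"
| FS1: "KG_axiom (Imp (Box (Imp \<phi> \<psi>)) (Imp (Dia \<phi>) (Dia \<psi>)))"
| FS2: "KG_axiom (Imp (Imp (Dia \<phi>) (Box \<psi>)) (Box (Imp \<phi> \<psi>)))"

inductive K45G_axiom :: "'v fm \<Rightarrow> bool" where
  K45G_KG: "KG_axiom \<phi> \<Longrightarrow> K45G_axiom \<phi>"
| Four_Box: "K45G_axiom (Imp (Box \<phi>) (Box (Box \<phi>)))"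
| Four_Dia: "K45G_axiom (Imp (Dia (Dia \<phi>)) (Dia \<phi>))"
| Five_Box: "K45G_axiom (Imp (Dia (Box \<phi>)) (Box \<phi>))"
| Five_Dia: "K45G_axiom (Imp (Dia \<phi>) (Box (Dia \<phi>)))"

text \<open>The empty assumption set in the premise of \<open>Nec\<close> restricts the rule to theorems.\<close>

inductive K45G_derivable :: "'v fm set \<Rightarrow> 'v fm \<Rightarrow> bool" (infix "\<turnstile>\<^sub>K\<^sub>4\<^sub>5\<^sub>G" 50) where
  Assm: "\<phi> \<in> T \<Longrightarrow> T \<turnstile>\<^sub>K\<^sub>4\<^sub>5\<^sub>G \<phi>"
| Ax: "K45G_axiom \<phi> \<Longrightarrow> T \<turnstile>\<^sub>K\<^sub>4\<^sub>5\<^sub>G \<phi>"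
| MP: "T \<turnstile>\<^sub>K\<^sub>4\<^sub>5\<^sub>G Imp \<phi> \<psi> \<Longrightarrow> T \<turnstile>\<^sub>K\<^sub>4\<^sub>5\<^sub>G \<phi> \<Longrightarrow> T \<turnstile>\<^sub>K\<^sub>4\<^sub>5\<^sub>G \<psi>"
| Nec: "{} \<turnstile>\<^sub>K\<^sub>4\<^sub>5\<^sub>G \<phi> \<Longrightarrow> T \<turnstile>\<^sub>K\<^sub>4\<^sub>5\<^sub>G Box \<phi>"

definition gimp :: "real \<Rightarrow> real \<Rightarrow> real" where
  "gimp x y = (if x \<le> y then 1 else y)"

text \<open>The worlds of a model form a subset \<open>W\<close> of a type; the values of \<open>\<pi>\<close> and \<open>e\<close>
  outside \<open>W\<close> are irrelevant.\<close>

definition PiG_model :: "'w set \<Rightarrow> ('w \<Rightarrow> real) \<Rightarrow> ('w \<Rightarrow> 'v \<Rightarrow> real) \<Rightarrow> bool" where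
  "PiG_model W \<pi> e \<longleftrightarrow>
     W \<noteq> {} \<and> (\<forall>w\<in>W. \<pi> w \<in> {0..1}) \<and> (\<forall>w\<in>W. \<forall>p. e w p \<in> {0..1})"

text \<open>In a model and at worlds of \<open>W\<close>, all values lie in \<open>[0,1]\<close>, so the infima and
  suprema below are taken over nonempty bounded sets of reals and agree with those of \<open>[0,1]\<close>.\<close>

primrec eval :: "'w set \<Rightarrow> ('w \<Rightarrow> real) \<Rightarrow> ('w \<Rightarrow> 'v \<Rightarrow> real) \<Rightarrow> 'v fm \<Rightarrow> 'w \<Rightarrow> real" where
  "eval W \<pi> e (Atom p) = (\<lambda>w. e w p)"
| "eval W \<pi> e Bot = (\<lambda>w. 0)"
| "eval W \<pi> e (And \<phi> \<psi>) = (\<lambda>w. min (eval W \<pi> e \<phi> w) (eval W \<pi> e \<psi> w))"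
| "eval W \<pi> e (Imp \<phi> \<psi>) = (\<lambda>w. gimp (eval W \<pi> e \<phi> w) (eval W \<pi> e \<psi> w))"
| "eval W \<pi> e (Box \<phi>) = (\<lambda>w. INF w'\<in>W. gimp (\<pi> w') (eval W \<pi> e \<phi> w'))"
| "eval W \<pi> e (Dia \<phi>) = (\<lambda>w. SUP w'\<in>W. min (\<pi> w') (eval W \<pi> e \<phi> w'))"

text \<open>A HOL formula cannot quantify over types, so the type \<open>'w\<close> that worlds are drawn from
  is a parameter. The set of worlds ranges over all nonempty subsets of \<open>'w\<close>.\<close>

definition PiG_entails :: "'w itself \<Rightarrow> 'v fm set \<Rightarrow> 'v fm \<Rightarrow> bool" where
  "PiG_entails (_ :: 'w itself) T \<phi> \<longleftrightarrow>
     (\<forall>(W :: 'w set) \<pi> e. PiG_model W \<pi> e \<longrightarrow>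
        (\<forall>w\<in>W. (\<forall>\<psi>\<in>T. eval W \<pi> e \<psi> w = 1) \<longrightarrow> eval W \<pi> e \<phi> w = 1))"

end

theory Submission
  imports Defs "HOL-Library.Countable_Set"
begin

text \<open>
  Completeness. Let \<open>P\<close> be a prime theory containing \<open>T\<close> but not \<open>\<phi>\<close>, let \<open>S\<close> be the finite set of
  subformulas of \<open>T\<close> and \<open>\<phi>\<close>, and let \<open>v\<close> be a valuation of \<open>S\<close> in \<open>[0,1]\<close> that represents the linear
  order of \<open>S\<close> modulo \<open>P\<close>. In the countermodel all worlds agree with \<open>v\<close> on the modal formulas of
  \<open>S\<close>. Suppose that \<open>v (Box \<psi>) < 1\<close>. The set of all \<open>\<theta>\<close> with \<open>Box \<theta>\<close> strictly above \<open>Box \<psi>\<close> in \<open>P\<close>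
  does not derive \<open>\<psi>\<close>, so some prime theory \<open>Q\<close> extends it and omits \<open>\<psi>\<close>. By the 4 and 5 axioms, the
  modal formulas up to \<open>Box \<psi>\<close> are ordered by \<open>Q\<close> as by \<open>P\<close> and lie outside \<open>Q\<close>, while those above
  lie in \<open>Q\<close>. Hence \<open>S - Q\<close> can be embedded below any \<open>t\<close> slightly above \<open>v (Box \<psi>)\<close> with the
  prescribed values on modal formulas, and the resulting world with possibility \<open>t\<close> witnesses
  \<open>Box \<psi>\<close> up to an arbitrarily small error. For \<open>Dia \<psi>\<close> one cuts at the largest modal formula \<open>c\<close> below
  \<open>Dia \<psi>\<close>, adds \<open>\<psi>\<close>, and omits \<open>c\<close>; here the value is even attained. Countably many worlds suffice.
\<close>

section \<open>Soundness\<close>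

text \<open>Residuation of \<open>min\<close> and \<open>gimp\<close>. It trades every lower bound
  on an implication, and hence on a box, for an inequality between minima.\<close>

lemma le_gimp_iff: "z \<le> 1 \<Longrightarrow> z \<le> gimp x y \<longleftrightarrow> min z x \<le> y"
  by (auto simp: gimp_def min_def)

lemma gimp_eq_1_iff: "x \<le> 1 \<Longrightarrow> y \<le> 1 \<Longrightarrow> gimp x y = 1 \<longleftrightarrow> x \<le> y"
  by (auto simp: gimp_def)

lemma gimp_range: "y \<in> {0..1} \<Longrightarrow> gimp x y \<in> {0..1}"
  by (auto simp: gimp_def)

lemma cINF_range:
  fixes f :: "'a \<Rightarrow> real"
  assumes "W \<noteq> {}" "\<forall>w\<in>W. f w \<in> {0..1}"
  shows "(INF w\<in>W. f w) \<in> {0..1}"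
proof -
  obtain w where w: "w \<in> W" using assms(1) by blast
  have "bdd_below (f ` W)" using assms(2) by (intro bdd_belowI[of _ 0]) auto
  then have "(INF w\<in>W. f w) \<le> f w" using w by (rule cINF_lower)
  moreover have "0 \<le> (INF w\<in>W. f w)" using assms by (intro cINF_greatest) auto
  ultimately show ?thesis using assms(2) w by force
qed

lemma cSUP_range:
  fixes f :: "'a \<Rightarrow> real"
  assumes "W \<noteq> {}" "\<forall>w\<in>W. f w \<in> {0..1}"
  shows "(SUP w\<in>W. f w) \<in> {0..1}"
proof -
  obtain w where w: "w \<in> W" using assms(1) by blast
  have "bdd_above (f ` W)" using assms(2) by (intro bdd_aboveI[of _ 1]) auto
  then have "f w \<le> (SUP w\<in>W. f w)" using w by (intro cSUP_upper) auto
  moreover have "(SUP w\<in>W. f w) \<le> 1" using assms by (intro cSUP_least) auto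
  ultimately show ?thesis using assms(2) w by force
qed

lemma eval_range:
  assumes "PiG_model W \<pi> e" "w \<in> W"
  shows "eval W \<pi> e \<phi> w \<in> {0..1}"
  using assms(2)
proof (induction \<phi> arbitrary: w)
  case (Atom p)
  then show ?case using assms(1) by (auto simp: PiG_model_def)
next
  case (Imp \<phi> \<psi>)
  then show ?case using gimp_range by simp
next
  case (Box \<phi>)
  have "gimp (\<pi> w') (eval W \<pi> e \<phi> w') \<in> {0..1}" if "w' \<in> W" for w'
    using Box.IH that gimp_range by blast
  then show ?case unfolding eval.simps using Box.prems by (intro cINF_range) auto
next
  case (Dia \<phi>)
  have "min (\<pi> w') (eval W \<pi> e \<phi> w') \<in> {0..1}" if "w' \<in> W" for w'
    using Dia.IH[OF that] assms(1) that by (auto simp: PiG_model_def min_def)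
  then show ?case unfolding eval.simps using Dia.prems by (intro cSUP_range) auto
qed (auto simp: min_def)

section \<open>Validity of the axioms in a fixed model\<close>

context
  fixes W :: "'w set" and \<pi> :: "'w \<Rightarrow> real" and e :: "'w \<Rightarrow> 'v \<Rightarrow> real"
  assumes model: "PiG_model W \<pi> e"
begin

lemma le_eval_Box_iff:
  assumes "z \<le> 1"
  shows "z \<le> eval W \<pi> e (Box \<phi>) w \<longleftrightarrow> (\<forall>w'\<in>W. min z (\<pi> w') \<le> eval W \<pi> e \<phi> w')"
proof -
  have "W \<noteq> {}" using model by (simp add: PiG_model_def)
  moreover have "bdd_below ((\<lambda>w'. gimp (\<pi> w') (eval W \<pi> e \<phi> w')) ` W)"
    using gimp_range eval_range[OF model] by (intro bdd_belowI[of _ 0]) fastforce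
  ultimately have "z \<le> eval W \<pi> e (Box \<phi>) w \<longleftrightarrow> (\<forall>w'\<in>W. z \<le> gimp (\<pi> w') (eval W \<pi> e \<phi> w'))"
    by (simp add: le_cINF_iff)
  then show ?thesis using le_gimp_iff[OF assms] by simp
qed

lemma eval_Dia_le_iff:
  "eval W \<pi> e (Dia \<phi>) w \<le> z \<longleftrightarrow> (\<forall>w'\<in>W. min (\<pi> w') (eval W \<pi> e \<phi> w') \<le> z)"
proof -
  have "W \<noteq> {}" using model by (simp add: PiG_model_def)
  moreover have "bdd_above ((\<lambda>w'. min (\<pi> w') (eval W \<pi> e \<phi> w')) ` W)"
    using eval_range[OF model, of _ \<phi>] by (intro bdd_aboveI[of _ 1]) (auto simp: min_le_iff_disj)
  ultimately show ?thesis by (simp add: cSUP_le_iff)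
qed

lemma eval_Imp_1_iff:
  "w \<in> W \<Longrightarrow> eval W \<pi> e (Imp \<phi> \<psi>) w = 1 \<longleftrightarrow> eval W \<pi> e \<phi> w \<le> eval W \<pi> e \<psi> w"
  using eval_range[OF model, of w \<psi>] eval_range[OF model, of w \<phi>] by (simp add: gimp_eq_1_iff)

lemma eval_Or:
  "w \<in> W \<Longrightarrow> eval W \<pi> e (Or \<phi> \<psi>) w = max (eval W \<pi> e \<phi> w) (eval W \<pi> e \<psi> w)"
  using eval_range[OF model, of w \<psi>] eval_range[OF model, of w \<phi>]
  by (auto simp: gimp_def min_def max_def)

lemma eval_Box_elim:
  assumes "w' \<in> W" "w \<in> W"
  shows "min (eval W \<pi> e (Box \<phi>) w) (\<pi> w') \<le> eval W \<pi> e \<phi> w'"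
proof -
  have "eval W \<pi> e (Box \<phi>) w \<le> 1"
    using eval_range[OF model assms(2), of "Box \<phi>"] by (simp del: eval.simps)
  then show ?thesis using le_eval_Box_iff[of "eval W \<pi> e (Box \<phi>) w" \<phi> w] assms(1) by blast
qed

lemma eval_Dia_intro:
  "w' \<in> W \<Longrightarrow> min (\<pi> w') (eval W \<pi> e \<phi> w') \<le> eval W \<pi> e (Dia \<phi>) w"
  using eval_Dia_le_iff by blast

text \<open>Possibility depends only on the target world, so modal values do not vary between
  worlds. This is what validates the 4 and 5 axioms.\<close>

lemma eval_modal_const:
  "eval W \<pi> e (Box \<phi>) w = eval W \<pi> e (Box \<phi>) w'"
  "eval W \<pi> e (Dia \<phi>) w = eval W \<pi> e (Dia \<phi>) w'"
  by simp_all

lemma G_axiom_sound: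
  assumes "G_axiom \<phi>" "w \<in> W"
  shows "eval W \<pi> e \<phi> w = 1"
  using assms
proof (induction rule: G_axiom.induct)
  case (G1 \<phi> \<psi> \<chi>)
  then show ?case using eval_range[OF model, of w] by (auto simp: gimp_def)
next
  case (G7 \<phi> \<psi> \<chi>)
  then have "eval W \<pi> e \<chi> w \<le> 1" using eval_range[OF model, of w \<chi>] by simp
  then show ?case by (auto simp: gimp_def)
next
  case (G8 \<phi>)
  then show ?case using eval_range[OF model, of w \<phi>] by (auto simp: gimp_def)
next
  case (G4 \<phi> \<psi> \<chi>)
  then show ?case using eval_range[OF model, of w] by (auto simp: gimp_def min_def)
next
  case (G5 \<phi> \<psi> \<chi>)
  then show ?case using eval_range[OF model, of w \<chi>] by (auto simp: gimp_def min_def)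
qed (auto simp: gimp_def min_def)

lemma KG_axiom_sound:
  assumes "KG_axiom \<phi>" "w \<in> W"
  shows "eval W \<pi> e \<phi> w = 1"
  using assms
proof (induction rule: KG_axiom.induct)
  case (KG_G \<phi>)
  then show ?case using G_axiom_sound by blast
next
  case (K_Box \<phi> \<psi>)
  let ?a = "eval W \<pi> e (Box (Imp \<phi> \<psi>)) w" and ?b = "eval W \<pi> e (Box \<phi>) w"
  have r: "?a \<le> 1" "?b \<le> 1"
    using eval_range[OF model K_Box, of "Box (Imp \<phi> \<psi>)"] eval_range[OF model K_Box, of "Box \<phi>"]
    by (simp_all del: eval.simps)
  have "min (min ?a ?b) (\<pi> w') \<le> eval W \<pi> e \<psi> w'" if w': "w' \<in> W" for w'
  proof -
    have "min ?a (\<pi> w') \<le> gimp (eval W \<pi> e \<phi> w') (eval W \<pi> e \<psi> w')"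
      using eval_Box_elim[OF w' K_Box, of "Imp \<phi> \<psi>"] by simp
    then have "min (min ?a (\<pi> w')) (eval W \<pi> e \<phi> w') \<le> eval W \<pi> e \<psi> w'"
      using r by (subst (asm) le_gimp_iff) auto
    then show ?thesis using eval_Box_elim[OF w' K_Box, of \<phi>] by (auto simp del: eval.simps)
  qed
  then have "min ?a ?b \<le> eval W \<pi> e (Box \<psi>) w"
    using r by (subst le_eval_Box_iff) auto
  then have "?a \<le> eval W \<pi> e (Imp (Box \<phi>) (Box \<psi>)) w"
    using le_gimp_iff[OF r(1)] by simp
  then show ?case using eval_Imp_1_iff[OF K_Box] by blast
next
  case (K_Dia \<phi> \<psi>)
  have "min (\<pi> w') (eval W \<pi> e (Or \<phi> \<psi>) w') \<le> eval W \<pi> e (Or (Dia \<phi>) (Dia \<psi>)) w"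
    if w': "w' \<in> W" for w'
    using eval_Dia_intro[OF w', of \<phi> w] eval_Dia_intro[OF w', of \<psi> w]
    unfolding eval_Or[OF w'] eval_Or[OF K_Dia] by linarith
  then show ?case using eval_Imp_1_iff[OF K_Dia] eval_Dia_le_iff by blast
next
  case F_Box
  then have "(INF w'\<in>W. 1) = (1::real)" by (intro cINF_const) blast
  then show ?case by (simp add: gimp_def)
next
  case F_Dia
  have "eval W \<pi> e (Dia Bot) w \<le> eval W \<pi> e Bot w" unfolding eval_Dia_le_iff by simp
  then show ?case using eval_Imp_1_iff[OF F_Dia] by blast
next
  case (FS1 \<phi> \<psi>)
  let ?a = "eval W \<pi> e (Box (Imp \<phi> \<psi>)) w"
  have r: "?a \<le> 1"
    using eval_range[OF model FS1, of "Box (Imp \<phi> \<psi>)"] by (simp del: eval.simps)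
  have le: "min (\<pi> w') (eval W \<pi> e \<phi> w') \<le> gimp ?a (eval W \<pi> e (Dia \<psi>) w)" if w': "w' \<in> W" for w'
  proof -
    have "min ?a (\<pi> w') \<le> gimp (eval W \<pi> e \<phi> w') (eval W \<pi> e \<psi> w')"
      using eval_Box_elim[OF w' FS1, of "Imp \<phi> \<psi>"] by simp
    then have "min (min ?a (\<pi> w')) (eval W \<pi> e \<phi> w') \<le> eval W \<pi> e \<psi> w'"
      using r by (subst (asm) le_gimp_iff) auto
    then have "min (min (\<pi> w') (eval W \<pi> e \<phi> w')) ?a \<le> eval W \<pi> e (Dia \<psi>) w"
      using eval_Dia_intro[OF w', of \<psi> w] by linarith
    then show ?thesis using eval_range[OF model w', of \<phi>] by (subst le_gimp_iff) auto
  qed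
  then have "eval W \<pi> e (Dia \<phi>) w \<le> gimp ?a (eval W \<pi> e (Dia \<psi>) w)"
    using eval_Dia_le_iff by blast
  moreover have "eval W \<pi> e (Dia \<phi>) w \<le> 1"
    using eval_range[OF model FS1, of "Dia \<phi>"] by (simp del: eval.simps)
  ultimately have "min ?a (eval W \<pi> e (Dia \<phi>) w) \<le> eval W \<pi> e (Dia \<psi>) w"
    by (subst (asm) le_gimp_iff) (auto simp: min.commute)
  then have "?a \<le> eval W \<pi> e (Imp (Dia \<phi>) (Dia \<psi>)) w"
    using le_gimp_iff[OF r] by simp
  then show ?case using eval_Imp_1_iff[OF FS1] by blast
next
  case (FS2 \<phi> \<psi>)
  let ?g = "eval W \<pi> e (Imp (Dia \<phi>) (Box \<psi>)) w"
  have r: "?g \<le> 1"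
    using eval_range[OF model FS2, of "Imp (Dia \<phi>) (Box \<psi>)"] by (simp del: eval.simps)
  have g: "min ?g (eval W \<pi> e (Dia \<phi>) w) \<le> eval W \<pi> e (Box \<psi>) w"
    using le_gimp_iff[OF r, of "eval W \<pi> e (Dia \<phi>) w" "eval W \<pi> e (Box \<psi>) w"] by simp
  have "min ?g (\<pi> w') \<le> eval W \<pi> e (Imp \<phi> \<psi>) w'" if w': "w' \<in> W" for w'
  proof -
    have "min (min ?g (\<pi> w')) (eval W \<pi> e \<phi> w') \<le> eval W \<pi> e \<psi> w'"
      using g eval_Dia_intro[OF w', of \<phi> w] eval_Box_elim[OF w' FS2, of \<psi>] by linarith
    then have "min ?g (\<pi> w') \<le> gimp (eval W \<pi> e \<phi> w') (eval W \<pi> e \<psi> w')"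
      using r by (subst le_gimp_iff) auto
    then show ?thesis by simp
  qed
  then have "?g \<le> eval W \<pi> e (Box (Imp \<phi> \<psi>)) w"
    using le_eval_Box_iff[OF r] by blast
  then show ?case using eval_Imp_1_iff[OF FS2] by blast
qed

lemma K45G_axiom_sound:
  assumes "K45G_axiom \<phi>" "w \<in> W"
  shows "eval W \<pi> e \<phi> w = 1"
  using assms
proof (induction rule: K45G_axiom.induct)
  case (K45G_KG \<phi>)
  then show ?case using KG_axiom_sound by blast
next
  case (Four_Box \<phi>)
  have "eval W \<pi> e (Box \<phi>) w \<le> 1"
    using eval_range[OF model Four_Box, of "Box \<phi>"] by (simp del: eval.simps)
  then have "eval W \<pi> e (Box \<phi>) w \<le> eval W \<pi> e (Box (Box \<phi>)) w"
    using eval_modal_const(1) by (subst le_eval_Box_iff) (auto simp: min_def)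
  then show ?case using eval_Imp_1_iff[OF Four_Box] by blast
next
  case (Four_Dia \<phi>)
  have "eval W \<pi> e (Dia (Dia \<phi>)) w \<le> eval W \<pi> e (Dia \<phi>) w"
    using eval_modal_const(2) by (subst eval_Dia_le_iff) (auto simp: min_def)
  then show ?case using eval_Imp_1_iff[OF Four_Dia] by blast
next
  case (Five_Box \<phi>)
  have "eval W \<pi> e (Dia (Box \<phi>)) w \<le> eval W \<pi> e (Box \<phi>) w"
    using eval_modal_const(1) by (subst eval_Dia_le_iff) (auto simp: min_def)
  then show ?case using eval_Imp_1_iff[OF Five_Box] by blast
next
  case (Five_Dia \<phi>)
  have "eval W \<pi> e (Dia \<phi>) w \<le> 1"
    using eval_range[OF model Five_Dia, of "Dia \<phi>"] by (simp del: eval.simps)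
  then have "eval W \<pi> e (Dia \<phi>) w \<le> eval W \<pi> e (Box (Dia \<phi>)) w"
    using eval_modal_const(2) by (subst le_eval_Box_iff) (auto simp: min_def)
  then show ?case using eval_Imp_1_iff[OF Five_Dia] by blast
qed

text \<open>The world stays arbitrary in the induction because \<open>Nec\<close> needs its premise
  at every world. That premise has no assumptions, so its induction hypothesis applies
  everywhere.\<close>

lemma derivable_sound:
  assumes "T \<turnstile>\<^sub>K\<^sub>4\<^sub>5\<^sub>G \<phi>" "w \<in> W" "\<forall>\<psi>\<in>T. eval W \<pi> e \<psi> w = 1"
  shows "eval W \<pi> e \<phi> w = 1"
  using assms
proof (induction arbitrary: w rule: K45G_derivable.induct)
  case (Ax \<phi> T)
  then show ?case using K45G_axiom_sound by blast
next
  case (MP T \<phi> \<psi>)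
  then have "eval W \<pi> e \<phi> w = 1" "eval W \<pi> e \<phi> w \<le> eval W \<pi> e \<psi> w"
    using eval_Imp_1_iff by blast+
  moreover have "eval W \<pi> e \<psi> w \<le> 1" using eval_range[OF model, of w \<psi>] MP.prems by auto
  ultimately show ?case by linarith
next
  case (Nec \<phi> T)
  then have "\<forall>w'\<in>W. eval W \<pi> e \<phi> w' = 1" by blast
  then have "1 \<le> eval W \<pi> e (Box \<phi>) w" by (subst le_eval_Box_iff) auto
  moreover have "eval W \<pi> e (Box \<phi>) w \<le> 1"
    using eval_range[OF model Nec.prems(1), of "Box \<phi>"] by (simp del: eval.simps)
  ultimately show ?case by linarith
qed blast

end

section \<open>Derivations and prime theories\<close>

notation K45G_derivable (infix "\<tturnstile>" 50)

section \<open>Propositional reasoning and the deduction theorem\<close>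

lemma derivable_G: "G_axiom \<phi> \<Longrightarrow> T \<tturnstile> \<phi>"
  by (intro Ax K45G_KG KG_G)

lemma derivable_KG: "KG_axiom \<phi> \<Longrightarrow> T \<tturnstile> \<phi>"
  by (intro Ax K45G_KG)

lemma derivable_mono: "T \<tturnstile> \<phi> \<Longrightarrow> T \<subseteq> T' \<Longrightarrow> T' \<tturnstile> \<phi>"
  by (induction arbitrary: T' rule: K45G_derivable.induct) (auto intro: K45G_derivable.intros)

lemma derivable_theorem: "{} \<tturnstile> \<phi> \<Longrightarrow> T \<tturnstile> \<phi>"
  using derivable_mono by blast

lemma derivable_trans: "T \<tturnstile> Imp a b \<Longrightarrow> T \<tturnstile> Imp b c \<Longrightarrow> T \<tturnstile> Imp a c"
  using MP[OF MP[OF derivable_G[OF G1]]] by blast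

lemma derivable_K: "T \<tturnstile> Imp a (Imp b a)"
  using MP[OF derivable_G[OF G5] derivable_G[OF G2]] .

lemma derivable_refl: "T \<tturnstile> Imp a a"
  using derivable_trans[OF derivable_G[OF G6] derivable_G[OF G2]] .

lemma derivable_exchange: "T \<tturnstile> Imp a (Imp b c) \<Longrightarrow> T \<tturnstile> Imp b (Imp a c)"
  using MP[OF derivable_G[OF G5] derivable_trans[OF derivable_G[OF G3] MP[OF derivable_G[OF G4]]]] .

lemma derivable_S:
  assumes "T \<tturnstile> Imp a (Imp b c)" "T \<tturnstile> Imp a b"
  shows "T \<tturnstile> Imp a c"
proof -
  have "T \<tturnstile> Imp a (Imp a c)" using derivable_trans[OF assms(2) derivable_exchange[OF assms(1)]] .
  then show ?thesis using derivable_trans[OF derivable_G[OF G6] MP[OF derivable_G[OF G4]]] by blast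
qed

text \<open>The \<open>Nec\<close> case survives because its premise is a theorem: the boxed formula
  is derivable from \<open>T\<close> alone, and weakening by \<open>derivable_K\<close> adds the
  antecedent.\<close>

lemma deduction: "insert a T \<tturnstile> b \<Longrightarrow> T \<tturnstile> Imp a b"
proof (induction "insert a T" b rule: K45G_derivable.induct)
  case (Assm \<phi>)
  then show ?case using derivable_refl MP[OF derivable_K K45G_derivable.Assm] by blast
next
  case (Ax \<phi>)
  then show ?case using MP[OF derivable_K K45G_derivable.Ax] by blast
next
  case (MP \<phi> \<psi>)
  then show ?case using derivable_S by blast
next
  case (Nec \<phi>)
  then show ?case using K45G_derivable.MP[OF derivable_K K45G_derivable.Nec] by blast
qed

lemma derivable_assm: "insert a T \<tturnstile> a"
  by (simp add: Assm)

lemma derivable_finite: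
  "T \<tturnstile> a \<Longrightarrow> \<exists>F. finite F \<and> F \<subseteq> T \<and> F \<tturnstile> a"
proof (induction rule: K45G_derivable.induct)
  case (Assm \<phi> T)
  then show ?case by (intro exI[of _ "{\<phi>}"]) (auto intro: K45G_derivable.Assm)
next
  case (MP T \<phi> \<psi>)
  then obtain F G where "finite F" "F \<subseteq> T" "F \<tturnstile> Imp \<phi> \<psi>" "finite G" "G \<subseteq> T" "G \<tturnstile> \<phi>" by blast
  moreover from this have "F \<union> G \<tturnstile> \<psi>"
    using K45G_derivable.MP[OF derivable_mono derivable_mono] by blast
  ultimately show ?case by (meson finite_UnI Un_least)
next
  case (Ax \<phi> T)
  then show ?case using K45G_derivable.Ax by blast
next
  case (Nec \<phi> T)
  then show ?case using K45G_derivable.Nec by blast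
qed

text \<open>Primeness is expressed by linearity: implication in \<open>P\<close> is then a total
  preorder on formulas. Closure under \<open>Box\<close> is not demanded, since \<open>Nec\<close>
  acts on theorems only.\<close>

definition prime_theory :: "'v fm set \<Rightarrow> bool" where
  "prime_theory P \<longleftrightarrow> Bot \<notin> P \<and> (\<forall>a. P \<tturnstile> a \<longrightarrow> a \<in> P) \<and> (\<forall>a b. Imp a b \<in> P \<or> Imp b a \<in> P)"

text \<open>Zorn gives a set maximal among the extensions of \<open>T\<close> that do not derive
  \<open>a\<close>. By maximality each \<open>x\<close> outside it satisfies
  \<open>P \<tturnstile> Imp x a\<close>, so if both directions of an implication were missing,
  \<open>G7\<close> would derive \<open>a\<close>.\<close>

lemma prime_theory_exists:
  assumes "\<not> T \<tturnstile> a"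
  shows "\<exists>P. prime_theory P \<and> T \<subseteq> P \<and> a \<notin> P"
proof -
  let ?A = "{P. T \<subseteq> P \<and> \<not> P \<tturnstile> a}"
  have "\<exists>M\<in>?A. \<forall>X\<in>?A. M \<subseteq> X \<longrightarrow> X = M"
  proof (rule subset_Zorn_nonempty)
    show "?A \<noteq> {}" using assms by blast
    fix C assume C: "C \<noteq> {}" "subset.chain ?A C"
    then have sub: "C \<subseteq> ?A" by (simp add: subset.chain_def)
    have "\<not> \<Union>C \<tturnstile> a"
    proof
      assume "\<Union>C \<tturnstile> a"
      then obtain F where F: "finite F" "F \<subseteq> \<Union>C" "F \<tturnstile> a" using derivable_finite by blast
      obtain X where "X \<in> C" "F \<subseteq> X"
        using finite_subset_Union_chain[OF F(1,2) C(1,2)] by blast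
      then show False using derivable_mono[OF F(3)] sub by blast
    qed
    then show "\<Union>C \<in> ?A" using sub C(1) by blast
  qed
  then obtain P where "P \<in> ?A" and max: "\<forall>X\<in>?A. P \<subseteq> X \<longrightarrow> X = P" by (rule bexE)
  then have P: "T \<subseteq> P" "\<not> P \<tturnstile> a" by simp_all
  have ded: "P \<tturnstile> Imp x a" if "x \<notin> P" for x
  proof (rule deduction, rule ccontr)
    assume "\<not> insert x P \<tturnstile> a"
    then have "insert x P \<in> ?A" using P(1) by blast
    then show False using max that by blast
  qed
  have closed: "x \<in> P" if "P \<tturnstile> x" for x
    using ded MP[of P x a] that P(2) by blast
  have "Imp x y \<in> P \<or> Imp y x \<in> P" for x y
    using MP[OF MP[OF derivable_G[OF G7] ded] ded] P(2) by blast
  moreover have "Bot \<notin> P"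
    using MP[OF derivable_G[OF G8] Assm] P(2) by blast
  moreover have "a \<notin> P" using P(2) Assm by blast
  ultimately show ?thesis using P(1) closed unfolding prime_theory_def by blast
qed

section \<open>The linear order of formulas modulo a prime theory\<close>

context
  fixes P :: "'v fm set"
  assumes P: "prime_theory P"
begin

lemma prime_closed: "P \<tturnstile> a \<Longrightarrow> a \<in> P"
  using P by (simp add: prime_theory_def)

lemma prime_theorem: "{} \<tturnstile> a \<Longrightarrow> a \<in> P"
  using prime_closed derivable_theorem by blast

lemma prime_Bot: "Bot \<notin> P"
  using P by (simp add: prime_theory_def)

lemma prime_total: "Imp a b \<in> P \<or> Imp b a \<in> P"
  using P by (simp add: prime_theory_def)

lemma prime_MP: "Imp a b \<in> P \<Longrightarrow> a \<in> P \<Longrightarrow> b \<in> P"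
  using prime_closed[OF MP[OF Assm Assm]] .

lemma prime_MP_theorem: "{} \<tturnstile> Imp a b \<Longrightarrow> a \<in> P \<Longrightarrow> b \<in> P"
  using prime_MP prime_theorem by blast

lemma prime_refl: "Imp a a \<in> P"
  using prime_closed derivable_refl by blast

lemma prime_trans: "Imp a b \<in> P \<Longrightarrow> Imp b c \<in> P \<Longrightarrow> Imp a c \<in> P"
  using prime_closed[OF derivable_trans[OF Assm Assm]] .

lemma prime_top: "b \<in> P \<Longrightarrow> Imp a b \<in> P"
  using prime_closed[OF MP[OF derivable_K Assm]] .

lemma prime_bot: "Imp Bot a \<in> P"
  using prime_closed derivable_G[OF G8] by blast

lemma prime_And:
  "Imp (And a b) a \<in> P" "Imp (And a b) b \<in> P"
  "Imp c a \<in> P \<Longrightarrow> Imp c b \<in> P \<Longrightarrow> Imp c (And a b) \<in> P"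
proof -
  show "Imp (And a b) a \<in> P" using prime_closed derivable_G[OF G2] by blast
  show "Imp (And a b) b \<in> P"
    using prime_closed derivable_trans[OF derivable_G[OF G3] derivable_G[OF G2]] by blast
  have "P \<tturnstile> Imp a (Imp b (And a b))" using MP[OF derivable_G[OF G5] derivable_refl] .
  then show "Imp c (And a b) \<in> P" if "Imp c a \<in> P" "Imp c b \<in> P"
    using that prime_closed derivable_S[OF derivable_trans Assm] Assm by blast
qed

text \<open>In a linear order a failing implication takes the value of its consequent. By
  contraction \<open>Imp a (Imp a b)\<close> fails as well, so linearity puts \<open>Imp a b\<close>
  below \<open>a\<close>, and detaching \<open>b\<close> puts it below \<open>b\<close>.\<close>

lemma prime_Imp_collapse:
  assumes "Imp a b \<notin> P"
  shows "Imp (Imp a b) b \<in> P"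
proof -
  have "Imp a (Imp a b) \<notin> P"
    using assms prime_closed[OF derivable_S[OF Assm derivable_refl]] by blast
  then have "Imp (Imp a b) a \<in> P" using prime_total by blast
  then show ?thesis using prime_closed[OF derivable_S[OF derivable_refl Assm]] by blast
qed

end

text \<open>Modal formulas are stable, and so are implications between them. The latter is what
  transfers the order of modal formulas from one prime theory to another.\<close>

definition stable :: "'v fm \<Rightarrow> bool" where
  "stable a \<longleftrightarrow> {} \<tturnstile> Imp a (Box a) \<and> {} \<tturnstile> Imp (Dia a) a"

lemma stable_Box: "stable (Box a)"
  unfolding stable_def using Ax Four_Box Five_Box by blast

lemma stable_Dia: "stable (Dia a)"
  unfolding stable_def using Ax Four_Dia Five_Dia by blast

lemma stable_Bot: "stable Bot"
  unfolding stable_def using derivable_G[OF G8] derivable_KG[OF F_Dia] by blast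

text \<open>For the box half, \<open>Imp a b\<close> chains \<open>Dia a\<close> through
  \<open>a\<close> and \<open>b\<close> to \<open>Box b\<close>, and \<open>FS2\<close> applies. For
  the diamond half, \<open>a\<close> yields \<open>Box a\<close>, hence
  \<open>Box (Imp (Imp a b) b)\<close>, and \<open>FS1\<close> leads from
  \<open>Dia (Imp a b)\<close> to \<open>Dia b\<close> and so to \<open>b\<close>.\<close>

lemma stable_Imp:
  assumes "stable a" "stable b"
  shows "stable (Imp a b)"
proof -
  have "{Imp a b} \<tturnstile> Imp (Dia a) (Box b)"
    using assms derivable_trans[OF derivable_theorem derivable_trans[OF derivable_assm derivable_theorem]]
    unfolding stable_def by blast
  then have "{Imp a b} \<tturnstile> Box (Imp a b)" using MP[OF derivable_KG[OF FS2]] by blast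
  moreover have "{} \<tturnstile> Imp (Dia (Imp a b)) (Imp a b)"
  proof (intro deduction)
    let ?T = "{a, Dia (Imp a b)}"
    have "{} \<tturnstile> Imp a (Imp (Imp a b) b)" using derivable_exchange derivable_refl by blast
    then have "?T \<tturnstile> Imp (Box a) (Box (Imp (Imp a b) b))" using MP[OF derivable_KG[OF K_Box] Nec] by blast
    moreover have "?T \<tturnstile> Box a"
      using assms(1) MP[OF derivable_theorem derivable_assm] unfolding stable_def by blast
    ultimately have "?T \<tturnstile> Imp (Dia (Imp a b)) (Dia b)" using MP[OF derivable_KG[OF FS1] MP] by blast
    then have "?T \<tturnstile> Dia b" using MP[OF _ Assm] by blast
    then show "?T \<tturnstile> b" using assms(2) MP[OF derivable_theorem] unfolding stable_def by blast
  qed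
  ultimately show ?thesis unfolding stable_def using deduction by blast
qed

text \<open>The T principle is obtained under a box only: the 5 axiom is exactly the premise of
  \<open>FS2\<close>. With its dual below it supplies the admissibility bounds at witness
  worlds.\<close>

lemma derivable_Box_T: "{} \<tturnstile> Box (Imp (Box a) a)"
  using MP[OF derivable_KG[OF FS2] Ax[OF Five_Box]] .

lemma derivable_Box_T_Dia: "{} \<tturnstile> Box (Imp a (Dia a))"
  using MP[OF derivable_KG[OF FS2] Ax[OF Five_Dia]] .

section \<open>Worlds from prime theories\<close>

text \<open>Elements are inserted one at a time into a finite chain of reals. The values lie
  strictly below \<open>t\<close>, so there is room above the largest one too, and the values on
  \<open>A\<close> are never changed.\<close>

lemma order_embedding_extend:
  fixes R :: "'a \<Rightarrow> 'a \<Rightarrow> bool" and g :: "'a \<Rightarrow> real"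
  assumes trans: "\<And>x y z. R x y \<Longrightarrow> R y z \<Longrightarrow> R x z" and total: "\<And>x y. R x y \<or> R y x"
    and bot: "least \<in> A" "\<And>x. R least x" and fin: "finite A" "finite F"
    and g: "\<forall>x\<in>A. 0 \<le> g x \<and> g x < t" "\<forall>x\<in>A. \<forall>y\<in>A. g x \<le> g y \<longleftrightarrow> R x y"
  shows "\<exists>h. (\<forall>x\<in>A. h x = g x) \<and> (\<forall>x\<in>A \<union> F. 0 \<le> h x \<and> h x < t) \<and>
           (\<forall>x\<in>A \<union> F. \<forall>y\<in>A \<union> F. h x \<le> h y \<longleftrightarrow> R x y)"
  using fin(2)
proof induction
  case empty
  show ?case using g by auto
next
  case (insert a F)
  let ?S = "A \<union> F"
  obtain h where h: "\<forall>x\<in>A. h x = g x" "\<forall>x\<in>?S. 0 \<le> h x \<and> h x < t"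
    "\<forall>x\<in>?S. \<forall>y\<in>?S. h x \<le> h y \<longleftrightarrow> R x y" using insert.IH by blast
  show ?case
  proof (cases "a \<in> A")
    case True
    then show ?thesis using h by (auto simp: insert_absorb)
  next
    case False
    have "\<exists>v. 0 \<le> v \<and> v < t \<and> (\<forall>x\<in>?S. (h x \<le> v \<longleftrightarrow> R x a) \<and> (v \<le> h x \<longleftrightarrow> R a x))"
    \<comment> \<open>An element equivalent to an old one must share its value; otherwise it goes
      into the gap between its lower and upper neighbours.\<close>
    proof (cases "\<exists>b\<in>?S. R a b \<and> R b a")
      case True
      then obtain b where b: "b \<in> ?S" "R a b" "R b a" by blast
      have "(h x \<le> h b \<longleftrightarrow> R x a) \<and> (h b \<le> h x \<longleftrightarrow> R a x)" if "x \<in> ?S" for x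
        using h(3) b that trans by blast
      then show ?thesis using h(2) b(1) by blast
    next
      case new: False
      define lo where "lo = Max (h ` {x \<in> ?S. R x a})"
      \<comment> \<open>Inserting \<open>t\<close> keeps the minimum defined when no old element
        lies above \<open>a\<close>, and forces the new value below \<open>t\<close>.\<close>
      define hi where "hi = Min (insert t (h ` {x \<in> ?S. \<not> R x a}))"
      have finS: "finite ?S" using fin(1) insert.hyps by simp
      have ne: "{x \<in> ?S. R x a} \<noteq> {}" using bot by blast
      have "lo \<in> h ` {x \<in> ?S. R x a}"
        unfolding lo_def using finS ne by (intro Max_in) auto
      then obtain b where b: "b \<in> ?S" "R b a" "lo = h b" by blast
      have lo: "h x \<le> lo" if "x \<in> ?S" "R x a" for x
        unfolding lo_def using finS that by (intro Max_ge) auto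
      have hi: "hi \<le> h x" if "x \<in> ?S" "\<not> R x a" for x
        unfolding hi_def using finS that by (intro Min_le) auto
      have "hi \<le> t" unfolding hi_def using finS by (intro Min_le) auto
      have "h b < h x" if "x \<in> ?S" "\<not> R x a" for x
        using h(3) b(1,2) that trans[of x b a] by (meson not_le)
      then have "lo < hi"
        unfolding hi_def using finS b h(2) by (subst Min_gr_iff) auto
      define v where "v = (lo + hi) / 2"
      have v: "lo < v" "v < hi" using \<open>lo < hi\<close> by (auto simp: v_def field_simps)
      have "(h x \<le> v \<longleftrightarrow> R x a) \<and> (v \<le> h x \<longleftrightarrow> R a x)" if x: "x \<in> ?S" for x
      proof (cases "R x a")
        case True
        then have "\<not> R a x" using new x by blast
        then show ?thesis using lo[OF x True] v True by auto
      next
        case False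
        then have "R a x" using total by blast
        then show ?thesis using hi[OF x False] v False by auto
      qed
      moreover have "0 \<le> h b" using b(1) h(2) by blast
      then have "0 \<le> v" using v(1) b(3) by simp
      moreover have "v < t" using v \<open>hi \<le> t\<close> by simp
      ultimately show ?thesis by blast
    qed
    then obtain v where v: "0 \<le> v" "v < t"
      "\<forall>x\<in>?S. (h x \<le> v \<longleftrightarrow> R x a) \<and> (v \<le> h x \<longleftrightarrow> R a x)" by blast
    have "R a a" using total by blast
    define h' where "h' = h(a := v)"
    have "\<forall>x\<in>A. h' x = g x" using h(1) False by (simp add: h'_def)
    moreover have "\<forall>x\<in>A \<union> insert a F. 0 \<le> h' x \<and> h' x < t"
      using h(2) v(1,2) by (simp add: h'_def)
    moreover have "h' x \<le> h' y \<longleftrightarrow> R x y" if "x \<in> A \<union> insert a F" "y \<in> A \<union> insert a F" for x y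
      using that h(3) v(3) \<open>R a a\<close> by (cases "x = a"; cases "y = a") (simp_all add: h'_def)
    ultimately show ?thesis by blast
  qed
qed

text \<open>Modal formulas are looked up in \<open>m\<close> instead of being computed, so a single
  world can be evaluated before the model around it exists.\<close>

primrec peval :: "('v \<Rightarrow> real) \<Rightarrow> ('v fm \<Rightarrow> real) \<Rightarrow> 'v fm \<Rightarrow> real" where
  "peval e m (Atom p) = e p"
| "peval e m Bot = 0"
| "peval e m (And a b) = min (peval e m a) (peval e m b)"
| "peval e m (Imp a b) = gimp (peval e m a) (peval e m b)"
| "peval e m (Box a) = m (Box a)"
| "peval e m (Dia a) = m (Dia a)"

definition subformula_closed :: "'v fm set \<Rightarrow> bool" where
  "subformula_closed S \<longleftrightarrow> Bot \<in> S \<and>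
     (\<forall>a b. And a b \<in> S \<longrightarrow> a \<in> S \<and> b \<in> S) \<and> (\<forall>a b. Imp a b \<in> S \<longrightarrow> a \<in> S \<and> b \<in> S) \<and>
     (\<forall>a. Box a \<in> S \<longrightarrow> a \<in> S) \<and> (\<forall>a. Dia a \<in> S \<longrightarrow> a \<in> S)"

primrec subfms :: "'v fm \<Rightarrow> 'v fm set" where
  "subfms (Atom p) = {Atom p}"
| "subfms Bot = {Bot}"
| "subfms (And a b) = insert (And a b) (subfms a \<union> subfms b)"
| "subfms (Imp a b) = insert (Imp a b) (subfms a \<union> subfms b)"
| "subfms (Box a) = insert (Box a) (subfms a)"
| "subfms (Dia a) = insert (Dia a) (subfms a)"

lemma finite_subfms: "finite (subfms a)"
  by (induction a) auto

lemma subfms_refl: "a \<in> subfms a"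
  by (cases a) auto

lemma subfms_trans: "b \<in> subfms a \<Longrightarrow> subfms b \<subseteq> subfms a"
  by (induction a) auto

lemma subformula_closed_subfms: "subformula_closed (insert Bot (\<Union>(subfms ` T)))"
proof -
  have sub: "b \<in> insert Bot (\<Union>(subfms ` T))"
    if "a \<in> insert Bot (\<Union>(subfms ` T))" "b \<in> subfms a" for a b
    using that subfms_trans by (cases "a = Bot") (simp, blast)
  show ?thesis unfolding subformula_closed_def
  proof (intro conjI allI impI)
    show "Bot \<in> insert Bot (\<Union>(subfms ` T))" by simp
  qed (erule sub, simp add: subfms_refl)+
qed

lemma subformula_closedD:
  assumes "subformula_closed S"
  shows "Bot \<in> S" "Box a \<in> S \<Longrightarrow> a \<in> S" "Dia a \<in> S \<Longrightarrow> a \<in> S"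
    "And a b \<in> S \<Longrightarrow> a \<in> S \<and> b \<in> S" "Imp a b \<in> S \<Longrightarrow> a \<in> S \<and> b \<in> S"
  using assms unfolding subformula_closed_def by blast+

text \<open>The two equations say that the prescribed values are the ones the model produces.
  Constructing the countermodel amounts to establishing them.\<close>

lemma eval_eq_peval:
  assumes "subformula_closed S"
    and "\<And>a. Box a \<in> S \<Longrightarrow> m (Box a) = (INF w\<in>W. gimp (\<pi> w) (peval (e w) m a))"
    and "\<And>a. Dia a \<in> S \<Longrightarrow> m (Dia a) = (SUP w\<in>W. min (\<pi> w) (peval (e w) m a))"
    and "a \<in> S" "w \<in> W"
  shows "eval W \<pi> e a w = peval (e w) m a"
  using assms(4,5)
proof (induction a arbitrary: w)
  case (And a b)
  then have "a \<in> S" "b \<in> S" using subformula_closedD[OF assms(1)] by blast+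
  then show ?case using And.IH And.prems(2) by simp
next
  case (Imp a b)
  then have "a \<in> S" "b \<in> S" using subformula_closedD[OF assms(1)] by blast+
  then show ?case using Imp.IH Imp.prems(2) by simp
next
  case (Box a)
  then have "a \<in> S" using subformula_closedD[OF assms(1)] by blast
  then have "(INF w\<in>W. gimp (\<pi> w) (eval W \<pi> e a w)) = m (Box a)"
    unfolding assms(2)[OF Box.prems(1)] using Box.IH by (intro INF_cong) auto
  then show ?case by simp
next
  case (Dia a)
  then have "a \<in> S" using subformula_closedD[OF assms(1)] by blast
  then have "(SUP w\<in>W. min (\<pi> w) (eval W \<pi> e a w)) = m (Dia a)"
    unfolding assms(3)[OF Dia.prems(1)] using Dia.IH by (intro SUP_cong) auto
  then show ?case by simp
qed simp_all

lemma peval_range: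
  assumes "subformula_closed S" "\<forall>p. e p \<in> {0..1}" "\<forall>a\<in>S. m a \<in> {0..1}" "a \<in> S"
  shows "peval e m a \<in> {0..1}"
  using assms(4)
proof (induction a)
  case (And a b)
  then have "a \<in> S" "b \<in> S" using subformula_closedD[OF assms(1)] by blast+
  then show ?case using And.IH by (auto simp: min_def)
next
  case (Imp a b)
  then have "b \<in> S" using subformula_closedD[OF assms(1)] by blast
  then show ?case using gimp_range[OF Imp.IH(2)] by simp
qed (use assms(2,3) in auto)

text \<open>\<open>Bot\<close> is included, so that a largest modal formula below a given positive value always exists.\<close>

definition modal :: "'v fm \<Rightarrow> bool" where
  "modal a \<longleftrightarrow> a = Bot \<or> (\<exists>b. a = Box b \<or> a = Dia b)"

lemma modal_stable: "modal a \<Longrightarrow> stable a"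
  unfolding modal_def using stable_Box stable_Dia stable_Bot by blast

text \<open>The formulas of \<open>P\<close> only get values of at least \<open>t\<close> instead of \<open>1\<close>: this leaves room
  for modal formulas in \<open>P\<close> with different prescribed values.\<close>

lemma peval_prime:
  assumes P: "prime_theory P" and S: "subformula_closed S"
    and h: "\<forall>a\<in>S - P. h a < t" "\<forall>a\<in>S - P. \<forall>b\<in>S - P. h a \<le> h b \<longleftrightarrow> Imp a b \<in> P"
      "h Bot = 0" and t: "t \<le> 1"
    and m: "\<forall>a\<in>S. modal a \<longrightarrow> (a \<notin> P \<longrightarrow> m a = h a) \<and> (a \<in> P \<longrightarrow> t \<le> m a \<and> m a \<le> 1)"
    and e: "e = (\<lambda>p. if Atom p \<in> S - P then h (Atom p) else 1)"
    and a: "a \<in> S"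
  shows "(a \<notin> P \<longrightarrow> peval e m a = h a) \<and> (a \<in> P \<longrightarrow> t \<le> peval e m a \<and> peval e m a \<le> 1)"
  using a
proof (induction a)
  case (Atom p)
  then show ?case using e t by auto
next
  case Bot
  then show ?case using h(3) prime_Bot[OF P] by simp
next
  case (And a b)
  then have ab: "a \<in> S" "b \<in> S" using subformula_closedD[OF S] by blast+
  note IH = And.IH(1)[OF ab(1)] And.IH(2)[OF ab(2)]
  note pr = prime_And[OF P, of a b] prime_And(3)[OF P prime_refl[OF P, of a], of b]
    prime_And(3)[OF P _ prime_refl[OF P, of b], of a]
  show ?case
  \<comment> \<open>A conjunction is equivalent modulo \<open>P\<close> to its smaller conjunct.
    When only one conjunct lies outside \<open>P\<close>, the threshold \<open>t\<close> separates
    the two values.\<close>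
  proof (cases "Imp a b \<in> P")
    case True
    then have "Imp (And a b) a \<in> P" "Imp a (And a b) \<in> P" using pr by blast+
    then have "And a b \<in> P \<longleftrightarrow> a \<in> P" "a \<notin> P \<longrightarrow> h (And a b) = h a"
      using prime_MP[OF P] h(2) And.prems ab by (blast, metis DiffI order_antisym)
    moreover have "a \<notin> P \<longrightarrow> peval e m a \<le> peval e m b"
      using IH True h(1,2) ab by (cases "b \<in> P") force+
    moreover have "a \<in> P \<longrightarrow> b \<in> P" using True prime_MP[OF P] by blast
    ultimately show ?thesis using IH by (auto simp: min_def)
  next
    case False
    then have ba: "Imp b a \<in> P" using prime_total[OF P] by blast
    then have "Imp (And a b) b \<in> P" "Imp b (And a b) \<in> P" using pr by blast+
    then have "And a b \<in> P \<longleftrightarrow> b \<in> P" "b \<notin> P \<longrightarrow> h (And a b) = h b"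
      using prime_MP[OF P] h(2) And.prems ab by (blast, metis DiffI order_antisym)
    moreover have "b \<notin> P \<longrightarrow> peval e m b \<le> peval e m a"
      using IH ba h(1,2) ab by (cases "a \<in> P") force+
    moreover have "b \<notin> P" using False prime_top[OF P] by blast
    ultimately show ?thesis using IH by (auto simp: min_def)
  qed
next
  case (Imp a b)
  then have ab: "a \<in> S" "b \<in> S" using subformula_closedD[OF S] by blast+
  note IH = Imp.IH(1)[OF ab(1)] Imp.IH(2)[OF ab(2)]
  show ?case
  proof (cases "Imp a b \<in> P")
    case True
    have "a \<notin> P \<longrightarrow> peval e m a \<le> peval e m b"
      using IH True h(1,2) ab by (cases "b \<in> P") force+
    moreover have "a \<in> P \<longrightarrow> b \<in> P" using True prime_MP[OF P] by blast
    ultimately show ?thesis using IH True t by (auto simp: gimp_def)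
  next
    case False
    then have b: "b \<notin> P" using prime_top[OF P] by blast
    have "Imp (Imp a b) b \<in> P" "Imp b (Imp a b) \<in> P"
      using prime_Imp_collapse[OF P False] prime_closed[OF P derivable_K] by blast+
    then have "h (Imp a b) = h b" using h(2) Imp.prems ab False b by (metis DiffI order_antisym)
    moreover have "\<not> peval e m a \<le> peval e m b"
      using IH False h(1,2) ab b by (cases "a \<in> P") force+
    ultimately show ?thesis using IH b False by (auto simp: gimp_def)
  qed
qed (use m in \<open>auto simp: modal_def\<close>)

text \<open>\<open>v\<close> prescribes the values of the modal formulas, \<open>r\<close> is the possibility of the world, and \<open>e\<close> gives
  its atoms: such a world can be added without violating the \<open>Box\<close> and \<open>Dia\<close> bounds.\<close>

definition admissible :: "'v fm set \<Rightarrow> ('v fm \<Rightarrow> real) \<Rightarrow> real \<Rightarrow> ('v \<Rightarrow> real) \<Rightarrow> bool" where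
  "admissible S v r e \<longleftrightarrow> r \<in> {0..1} \<and> (\<forall>p. e p \<in> {0..1}) \<and>
     (\<forall>a. Box a \<in> S \<longrightarrow> min (v (Box a)) r \<le> peval e v a) \<and>
     (\<forall>a. Dia a \<in> S \<longrightarrow> min r (peval e v a) \<le> v (Dia a))"

definition valuation :: "'v fm set \<Rightarrow> 'v fm set \<Rightarrow> ('v fm \<Rightarrow> real) \<Rightarrow> bool" where
  "valuation P S v \<longleftrightarrow> v Bot = 0 \<and> (\<forall>a\<in>S. v a \<in> {0..1} \<and> (v a = 1 \<longleftrightarrow> a \<in> P)) \<and>
     (\<forall>a\<in>S. \<forall>b\<in>S. v a \<le> v b \<longleftrightarrow> Imp a b \<in> P)"

text \<open>The formulas of \<open>P\<close> form the top class and get 1. The others are embedded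
  strictly below 1, starting from \<open>Bot\<close> at 0.\<close>

lemma valuation_exists:
  assumes P: "prime_theory P" and S: "subformula_closed S" "finite S"
  shows "\<exists>v. valuation P S v"
proof -
  have "\<exists>h. (\<forall>x\<in>{Bot}. h x = 0) \<and> (\<forall>x\<in>{Bot} \<union> (S - P). 0 \<le> h x \<and> h x < (1::real)) \<and>
      (\<forall>x\<in>{Bot} \<union> (S - P). \<forall>y\<in>{Bot} \<union> (S - P). h x \<le> h y \<longleftrightarrow> Imp x y \<in> P)"
    by (rule order_embedding_extend[where least = Bot])
      (use prime_trans[OF P] prime_total[OF P] prime_bot[OF P] S(2) in auto)
  then obtain h where h: "h Bot = 0" "\<forall>x\<in>S - P. 0 \<le> h x \<and> h x < (1::real)"
    "\<forall>x\<in>S - P. \<forall>y\<in>S - P. h x \<le> h y \<longleftrightarrow> Imp x y \<in> P" by blast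
  define v where "v a = (if a \<in> P then 1 else h a)" for a
  have "v a \<le> v b \<longleftrightarrow> Imp a b \<in> P" if "a \<in> S" "b \<in> S" for a b
    using that h prime_MP[OF P, of a b] prime_top[OF P, of b a] by (force simp: v_def)
  then have "valuation P S v"
    unfolding valuation_def using h prime_Bot[OF P] by (force simp: v_def)
  then show ?thesis by blast
qed

section \<open>Admissible worlds and witnesses for a fixed prime theory and valuation\<close>

context
  fixes P :: "'v fm set" and S :: "'v fm set" and v :: "'v fm \<Rightarrow> real"
  assumes P: "prime_theory P" and S: "subformula_closed S" "finite S" and v: "valuation P S v"
begin

lemma valuation_range: "a \<in> S \<Longrightarrow> v a \<in> {0..1}"
  using v by (simp add: valuation_def)

lemma valuation_eq_1_iff: "a \<in> S \<Longrightarrow> v a = 1 \<longleftrightarrow> a \<in> P"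
  using v by (simp add: valuation_def)

lemma valuation_le_iff: "a \<in> S \<Longrightarrow> b \<in> S \<Longrightarrow> v a \<le> v b \<longleftrightarrow> Imp a b \<in> P"
  using v by (simp add: valuation_def)

lemma valuation_Bot: "v Bot = 0"
  using v by (simp add: valuation_def)

text \<open>Possibility 0 makes the admissibility bounds trivial, so \<open>P\<close> itself can be
  realised, with \<open>v\<close> as embedding and threshold 1.\<close>

lemma root_world:
  "\<exists>e. admissible S v 0 e \<and> (\<forall>a\<in>S. peval e v a = 1 \<longleftrightarrow> a \<in> P)"
proof -
  define e where "e = (\<lambda>p. if Atom p \<in> S - P then v (Atom p) else 1)"
  have e: "\<forall>p. e p \<in> {0..1}" using valuation_range by (simp add: e_def)
  have lt: "\<forall>a\<in>S - P. v a < 1" using valuation_range valuation_eq_1_iff by force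
  have "(a \<notin> P \<longrightarrow> peval e v a = v a) \<and> (a \<in> P \<longrightarrow> 1 \<le> peval e v a \<and> peval e v a \<le> 1)"
    if "a \<in> S" for a
    by (rule peval_prime[OF P S(1) lt _ valuation_Bot _ _ e_def that]) (use valuation_le_iff valuation_eq_1_iff in force)+
  then have "peval e v a = 1 \<longleftrightarrow> a \<in> P" if "a \<in> S" for a
    using that valuation_eq_1_iff by force
  moreover have "admissible S v 0 e"
    unfolding admissible_def
  proof (intro conjI allI impI)
    fix a
    have range: "v b \<in> {0..1}" "peval e v b \<in> {0..1}" if "b \<in> S" for b
      using that valuation_range peval_range[OF S(1) e] by blast+
    show "min (v (Box a)) 0 \<le> peval e v a" if "Box a \<in> S"
      using range(2)[OF subformula_closedD(2)[OF S(1) that]] by (simp add: min_le_iff_disj)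
    show "min 0 (peval e v a) \<le> v (Dia a)" if "Dia a \<in> S"
      using range(1)[OF that] by (simp add: min_le_iff_disj)
  qed (use e in auto)
  ultimately show ?thesis by blast
qed

text \<open>The formula \<open>c\<close> marks a cut. Modal formulas of \<open>S\<close> up to
  \<open>c\<close> lie outside \<open>Q\<close> and keep their values from \<open>v\<close>; those
  above it lie in \<open>Q\<close> and have values at least \<open>t\<close>. This is the situation
  that \<open>peval_prime\<close> requires.\<close>

lemma witness_world:
  assumes c: "c \<in> S" "c \<notin> P" and Q: "prime_theory Q"
    and box: "\<And>a. Imp (Box a) c \<notin> P \<Longrightarrow> a \<in> Q"
    and avoid: "\<And>b. stable b \<Longrightarrow> Imp b c \<in> P \<Longrightarrow> b \<notin> Q"
    and t: "v c < t" "t \<le> 1" "\<forall>a\<in>S. modal a \<longrightarrow> v c < v a \<longrightarrow> t \<le> v a"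
  shows "\<exists>e. admissible S v t e \<and>
           (\<forall>a\<in>S. (a \<in> Q \<longrightarrow> t \<le> peval e v a) \<and> (a \<notin> Q \<longrightarrow> peval e v a < t))"
proof -
  have boxP: "a \<in> Q" if "Box a \<in> P" for a
    using box that c(2) prime_MP[OF P] by blast
  define A where "A = {a \<in> S. modal a \<and> Imp a c \<in> P}"
  have AQ: "A \<subseteq> S - Q" using avoid modal_stable by (auto simp: A_def)
  have nA: "a \<in> Q" if "a \<in> S" "modal a" "a \<notin> A" for a
  proof -
    have "Imp a (Box a) \<in> P"
      using modal_stable[OF that(2)] prime_theorem[OF P] by (auto simp: stable_def)
    then show ?thesis using box that prime_trans[OF P] unfolding A_def by blast
  qed
  \<comment> \<open>\<open>P\<close> and \<open>Q\<close> agree on \<open>Imp a b\<close>: if it is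
    in \<open>P\<close>, stability boxes it and \<open>boxP\<close> carries it to \<open>Q\<close>;
    if not, it collapses to \<open>b\<close>, hence lies below \<open>c\<close>, and being stable it
    is avoided by \<open>Q\<close>.\<close>
  have ord: "v a \<le> v b \<longleftrightarrow> Imp a b \<in> Q" if "a \<in> A" "b \<in> A" for a b
  proof -
    have st: "stable (Imp a b)" using that modal_stable stable_Imp by (auto simp: A_def)
    show ?thesis
    proof (cases "Imp a b \<in> P")
      case True
      then have "Imp a b \<in> Q"
        using st boxP prime_MP_theorem[OF P] unfolding stable_def by blast
      then show ?thesis using True valuation_le_iff that by (auto simp: A_def)
    next
      case False
      then have "Imp (Imp a b) c \<in> P"
        using prime_trans[OF P prime_Imp_collapse[OF P False]] that by (auto simp: A_def)
      then show ?thesis using avoid[OF st] False valuation_le_iff that by (auto simp: A_def)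
    qed
  qed
  have "\<exists>h. (\<forall>x\<in>A. h x = v x) \<and> (\<forall>x\<in>A \<union> (S - Q). 0 \<le> h x \<and> h x < t) \<and>
      (\<forall>x\<in>A \<union> (S - Q). \<forall>y\<in>A \<union> (S - Q). h x \<le> h y \<longleftrightarrow> Imp x y \<in> Q)"
  proof (rule order_embedding_extend[where least = Bot])
    show "Bot \<in> A"
      using subformula_closedD(1)[OF S(1)] prime_bot[OF P] by (auto simp: A_def modal_def)
    show "\<forall>x\<in>A. 0 \<le> v x \<and> v x < t" using valuation_range valuation_le_iff c(1) t(1) by (fastforce simp: A_def)
  qed (use prime_trans[OF Q] prime_total[OF Q] prime_bot[OF Q] S(2) ord in \<open>auto simp: A_def\<close>)
  then obtain h where h: "\<forall>x\<in>A. h x = v x" "\<forall>x\<in>S - Q. 0 \<le> h x \<and> h x < t"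
    "\<forall>x\<in>S - Q. \<forall>y\<in>S - Q. h x \<le> h y \<longleftrightarrow> Imp x y \<in> Q" by blast
  define e where "e = (\<lambda>p. if Atom p \<in> S - Q then h (Atom p) else 1)"
  have e: "\<forall>p. e p \<in> {0..1}" using h(2) t(2) by (force simp: e_def)
  have Bot: "Bot \<in> A"
    using subformula_closedD(1)[OF S(1)] prime_bot[OF P] by (auto simp: A_def modal_def)
  have mod: "\<forall>a\<in>S. modal a \<longrightarrow> (a \<notin> Q \<longrightarrow> v a = h a) \<and> (a \<in> Q \<longrightarrow> t \<le> v a \<and> v a \<le> 1)"
  proof (intro ballI impI)
    fix a assume a: "a \<in> S" "modal a"
    have "t \<le> v a" if "a \<in> Q"
      using that AQ a t(3) valuation_le_iff[OF a(1) c(1)] by (force simp: A_def)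
    then show "(a \<notin> Q \<longrightarrow> v a = h a) \<and> (a \<in> Q \<longrightarrow> t \<le> v a \<and> v a \<le> 1)"
      using nA[OF a] h(1) valuation_range[OF a(1)] by (metis atLeastAtMost_iff)
  qed
  have pe: "(a \<notin> Q \<longrightarrow> peval e v a = h a) \<and> (a \<in> Q \<longrightarrow> t \<le> peval e v a \<and> peval e v a \<le> 1)"
    if "a \<in> S" for a
    by (rule peval_prime[OF Q S(1) _ h(3) _ t(2) mod e_def that]) (use h Bot valuation_Bot in auto)
  \<comment> \<open>Inside \<open>Q\<close> values are known only to lie between \<open>t\<close>
    and 1, so implications in \<open>Q\<close> give inequalities up to \<open>t\<close>. As
    \<open>t\<close> is the possibility of the world, this is the precision admissibility asks
    for.\<close>
  have mono: "min t (peval e v a) \<le> peval e v b" if "a \<in> S" "b \<in> S" "Imp a b \<in> Q" for a b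
  proof -
    have "h a \<le> h b" if "a \<notin> Q" "b \<notin> Q" using h(3) \<open>a \<in> S\<close> \<open>b \<in> S\<close> \<open>Imp a b \<in> Q\<close> that by blast
    then show ?thesis
      using pe[OF that(1)] pe[OF that(2)] prime_MP[OF Q that(3)]
      by (cases "a \<in> Q"; cases "b \<in> Q") (auto simp: min_def)
  qed
  have "min (v (Box a)) t \<le> peval e v a" if "Box a \<in> S" for a
    using mono[OF that subformula_closedD(2)[OF S(1) that]] boxP[OF prime_theorem[OF P derivable_Box_T]]
    by (simp add: min.commute)
  moreover have "min t (peval e v a) \<le> v (Dia a)" if "Dia a \<in> S" for a
    using mono[OF subformula_closedD(3)[OF S(1) that] that] boxP[OF prime_theorem[OF P derivable_Box_T_Dia]]
    by simp
  moreover have "t \<in> {0..1}" using t valuation_range[OF c(1)] by simp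
  ultimately have "admissible S v t e" unfolding admissible_def using e by blast
  then show ?thesis using pe h(2) by (intro exI[of _ e]) auto
qed

text \<open>For modus ponens, suppose \<open>Box \<psi>\<close> were below \<open>c\<close>. Then
  \<open>Imp (Box \<phi>) (Box \<psi>)\<close> fails in \<open>P\<close> and collapses to
  \<open>Box \<psi>\<close>, so \<open>K_Box\<close> would pull
  \<open>Box (Imp \<phi> \<psi>)\<close> below \<open>c\<close>.\<close>

lemma above_cut_closed:
  assumes "c \<notin> P" "{a. Imp (Box a) c \<notin> P} \<tturnstile> b"
  shows "Imp (Box b) c \<notin> P"
proof -
  have nec: "Imp (Box a) c \<notin> P" if "{} \<tturnstile> a" for a
    using that Nec prime_theorem[OF P] prime_MP[OF P] assms(1) by blast
  show ?thesis
    using assms(2)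
  proof (induction "{a. Imp (Box a) c \<notin> P}" b rule: K45G_derivable.induct)
    case (Ax \<phi>)
    then show ?case using nec K45G_derivable.Ax by blast
  next
    case (Nec \<phi>)
    then show ?case using nec K45G_derivable.Nec by blast
  next
    case (MP \<phi> \<psi>)
    show ?case
    proof
      assume c: "Imp (Box \<psi>) c \<in> P"
      then have "Imp (Box \<phi>) (Box \<psi>) \<notin> P" using MP prime_trans[OF P] by blast
      then have "Imp (Imp (Box \<phi>) (Box \<psi>)) c \<in> P"
        using prime_trans[OF P prime_Imp_collapse[OF P] c] by blast
      moreover have "Imp (Box (Imp \<phi> \<psi>)) (Imp (Box \<phi>) (Box \<psi>)) \<in> P"
        using prime_closed[OF P derivable_KG[OF K_Box]] .
      ultimately show False using MP prime_trans[OF P] by blast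
    qed
  qed blast
qed

text \<open>The chain from \<open>Dia b\<close> through \<open>b\<close> and \<open>c\<close> to
  \<open>Box d\<close> gives \<open>Box (Imp b d)\<close> by \<open>FS2\<close>, so
  \<open>Imp b d\<close> is in \<open>Q\<close>, which omits \<open>d\<close>. Box witnesses take
  \<open>d\<close> to be the body of \<open>c\<close>; diamond witnesses take \<open>c\<close>
  itself.\<close>

lemma avoid_below_cut:
  assumes "c \<notin> P" "\<And>a. Imp (Box a) c \<notin> P \<Longrightarrow> a \<in> Q" "prime_theory Q" "d \<notin> Q"
    and "Imp c (Box d) \<in> P" "stable b" "Imp b c \<in> P"
  shows "b \<notin> Q"
proof -
  have "Imp (Dia b) (Box d) \<in> P"
    using prime_trans[OF P prime_trans[OF P prime_theorem[OF P]]] assms(5-7)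
    unfolding stable_def by blast
  then have "Box (Imp b d) \<in> P" using prime_MP_theorem[OF P derivable_KG[OF FS2]] by blast
  then have "Imp b d \<in> Q" using assms(1,2) prime_MP[OF P] by blast
  then show ?thesis using prime_MP[OF assms(3)] assms(4) by blast
qed

lemma Box_witness:
  assumes a: "Box a \<in> S" "v (Box a) < 1" and \<epsilon>: "\<epsilon> > 0"
  shows "\<exists>r e. admissible S v r e \<and> gimp r (peval e v a) < v (Box a) + \<epsilon>"
proof -
  let ?c = "Box a"
  let ?G = "{b. Imp (Box b) ?c \<notin> P}"
  have c: "?c \<notin> P" using a valuation_eq_1_iff by force
  have "\<not> ?G \<tturnstile> a" using above_cut_closed[OF c, of a] prime_refl[OF P] by blast
  then obtain Q where Q: "prime_theory Q" "?G \<subseteq> Q" "a \<notin> Q" using prime_theory_exists by blast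
  \<comment> \<open>The possibility is close to \<open>v (Box a)\<close>, yet does not exceed 1 or
    the next larger value of \<open>v\<close> on \<open>S\<close>.\<close>
  define t where "t = Min (insert 1 (insert (v ?c + \<epsilon> / 2) (v ` {b \<in> S. v ?c < v b})))"
  have fin: "finite (insert 1 (insert (v ?c + \<epsilon> / 2) (v ` {b \<in> S. v ?c < v b})))"
    using S(2) by simp
  have t: "v ?c < t" "t \<le> 1" "t \<le> v ?c + \<epsilon> / 2" "\<forall>b\<in>S. v ?c < v b \<longrightarrow> t \<le> v b"
    unfolding t_def using fin a(2) \<epsilon> Min_le[OF fin] by (simp_all add: Min_gr_iff)
  have box: "b \<in> Q" if "Imp (Box b) ?c \<notin> P" for b using Q(2) that by blast
  have avoid: "b \<notin> Q" if "stable b" "Imp b ?c \<in> P" for b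
    by (rule avoid_below_cut[OF c box Q(1,3) prime_refl[OF P] that])
  have "\<forall>b\<in>S. modal b \<longrightarrow> v ?c < v b \<longrightarrow> t \<le> v b" using t(4) by blast
  then obtain e where e: "admissible S v t e" "peval e v a < t"
    using witness_world[OF a(1) c Q(1) box avoid t(1,2)] Q(3) subformula_closedD(2)[OF S(1) a(1)] by blast
  then have "gimp t (peval e v a) < v ?c + \<epsilon>" using t(3) \<epsilon> by (simp add: gimp_def)
  then show ?thesis using e(1) by blast
qed

lemma Dia_witness:
  assumes a: "Dia a \<in> S" "v (Dia a) > 0"
  shows "\<exists>r e. admissible S v r e \<and> v (Dia a) \<le> min r (peval e v a)"
proof -
  \<comment> \<open>\<open>Bot\<close> counts as modal, so \<open>M\<close> is nonempty. Cutting at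
    its largest value leaves no modal value strictly between \<open>c\<close> and
    \<open>Dia a\<close>, so \<open>v (Dia a)\<close> itself can serve as the possibility.\<close>
  define M where "M = {b \<in> S. modal b \<and> v b < v (Dia a)}"
  have "Bot \<in> M"
    using subformula_closedD(1)[OF S(1)] a(2) valuation_Bot by (auto simp: M_def modal_def)
  moreover have "finite M" using S(2) by (simp add: M_def)
  ultimately have "Max (v ` M) \<in> v ` M" by (intro Max_in) auto
  then obtain c where c: "c \<in> M" "v c = Max (v ` M)" by auto
  have max: "v b \<le> v c" if "b \<in> M" for b
    using that c(2) \<open>finite M\<close> by simp
  have cS: "c \<in> S" "modal c" "v c < v (Dia a)" using c(1) by (auto simp: M_def)
  have st: "Imp c (Box c) \<in> P" "Imp (Dia c) c \<in> P"
    using modal_stable[OF cS(2)] prime_theorem[OF P] unfolding stable_def by blast+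
  have cP: "c \<notin> P" using cS(3) valuation_eq_1_iff[OF cS(1)] valuation_range[OF a(1)] by auto
  let ?G = "{b. Imp (Box b) c \<notin> P}"
  \<comment> \<open>Otherwise \<open>Box (Imp a c)\<close> would lie strictly above
    \<open>c\<close>. But \<open>FS1\<close> puts it below \<open>Imp (Dia a) (Dia c)\<close>, which
    fails in \<open>P\<close> and collapses to \<open>Dia c\<close>, hence below \<open>c\<close> by
    stability.\<close>
  have "\<not> insert a ?G \<tturnstile> c"
  proof
    assume "insert a ?G \<tturnstile> c"
    then have "Imp (Box (Imp a c)) c \<notin> P" using above_cut_closed[OF cP] deduction by blast
    moreover have "Imp (Dia a) (Dia c) \<notin> P"
      using valuation_le_iff[OF a(1) cS(1)] cS(3) st(2) prime_trans[OF P] by force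
    then have "Imp (Imp (Dia a) (Dia c)) c \<in> P"
      using prime_trans[OF P prime_Imp_collapse[OF P] st(2)] by blast
    ultimately show False
      using prime_trans[OF P prime_closed[OF P derivable_KG[OF FS1]]] by blast
  qed
  then obtain Q where Q: "prime_theory Q" "insert a ?G \<subseteq> Q" "c \<notin> Q" using prime_theory_exists by blast
  have box: "b \<in> Q" if "Imp (Box b) c \<notin> P" for b using Q(2) that by blast
  have avoid: "b \<notin> Q" if "stable b" "Imp b c \<in> P" for b
    by (rule avoid_below_cut[OF cP box Q(1,3) st(1) that])
  have t: "v (Dia a) \<le> 1" using valuation_range[OF a(1)] by simp
  have "\<forall>b\<in>S. modal b \<longrightarrow> v c < v b \<longrightarrow> v (Dia a) \<le> v b"
    using max by (force simp: M_def)
  then obtain e where "admissible S v (v (Dia a)) e" "v (Dia a) \<le> peval e v a"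
    using witness_world[OF cS(1) cP Q(1) box avoid cS(3) t] Q(2) subformula_closedD(3)[OF S(1) a(1)]
    by blast
  then show ?thesis by fastforce
qed

end

section \<open>Completeness\<close>

text \<open>The worlds are the root and one witness for each formula of \<open>S\<close> and each
  precision \<open>1 / Suc n\<close>. They are countably many, so an infinite type can host
  them.\<close>

lemma countermodel:
  fixes T :: "'v fm set"
  assumes inf: "infinite (UNIV :: 'w set)" and T: "finite T" "\<not> T \<tturnstile> \<phi>"
  shows "\<exists>(W :: 'w set) \<pi> e. PiG_model W \<pi> e \<and>
           (\<exists>w\<in>W. (\<forall>\<psi>\<in>T. eval W \<pi> e \<psi> w = 1) \<and> eval W \<pi> e \<phi> w \<noteq> 1)"
proof -
  obtain P where P: "prime_theory P" "T \<subseteq> P" "\<phi> \<notin> P" using prime_theory_exists[OF T(2)] by blast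
  define S where "S = insert Bot (\<Union>(subfms ` insert \<phi> T))"
  have S: "subformula_closed S" "finite S"
    using subformula_closed_subfms[of "insert \<phi> T"] T(1) by (simp_all add: S_def finite_subfms)
  have TS: "T \<subseteq> S" "\<phi> \<in> S" using subfms_refl unfolding S_def by blast+
  obtain v where v: "valuation P S v" using valuation_exists[OF P(1) S] by blast
  obtain e0 where e0: "admissible S v 0 e0" "\<forall>a\<in>S. peval e0 v a = 1 \<longleftrightarrow> a \<in> P"
    using root_world[OF P(1) S v] by blast
  define good where "good = (\<lambda>c n (r, e). admissible S v r e \<and>
      (\<forall>a. c = Box a \<longrightarrow> v c < 1 \<longrightarrow> gimp r (peval e v a) < v c + 1 / real (Suc n)) \<and>
      (\<forall>a. c = Dia a \<longrightarrow> 0 < v c \<longrightarrow> v c \<le> min r (peval e v a)))"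
  have "\<exists>x. good c n x" if c: "c \<in> S" for c and n :: nat
  proof -
    consider a where "c = Box a" "v c < 1" | a where "c = Dia a" "0 < v c"
      | "\<forall>a. c = Box a \<longrightarrow> \<not> v c < 1" "\<forall>a. c = Dia a \<longrightarrow> \<not> 0 < v c" by blast
    then show ?thesis
    proof cases
      case 1
      then show ?thesis
        using Box_witness[OF P(1) S v, of a "1 / real (Suc n)"] c by (auto simp: good_def)
    next
      case 2
      then show ?thesis using Dia_witness[OF P(1) S v, of a] c by (auto simp: good_def)
    next
      case 3
      \<comment> \<open>Formulas that demand no witness are served by the root.\<close>
      then have "good c n (0, e0)" using e0(1) by (auto simp: good_def)
      then show ?thesis by blast
    qed
  qed
  then obtain f where f: "\<And>c n. c \<in> S \<Longrightarrow> good c n (f c n)" by metis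
  define X where "X = insert (0, e0) ((\<lambda>(c, n). f c n) ` (S \<times> (UNIV :: nat set)))"
  have "countable X" unfolding X_def using S(2) by (simp add: countable_finite)
  moreover have "X \<noteq> {}" by (simp add: X_def)
  ultimately have "range (from_nat_into X) = X" by (intro range_from_nat_into)
  \<comment> \<open>Worlds are indexed by naturals and carried into \<open>'w\<close> along
    \<open>\<iota>\<close>. Repetitions in the enumeration do not affect infima and suprema.\<close>
  then obtain g :: "nat \<Rightarrow> real \<times> ('v \<Rightarrow> real)" where g: "range g = X" by blast
  obtain \<iota> :: "nat \<Rightarrow> 'w" where \<iota>: "inj \<iota>" using infinite_countable_subset[OF inf] by blast
  define W where "W = range \<iota>"
  define \<pi> where "\<pi> w = fst (g (inv \<iota> w))" for w
  define e where "e w = snd (g (inv \<iota> w))" for w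
  have adm_X: "admissible S v (fst x) (snd x)" if "x \<in> X" for x
  proof -
    consider "x = (0, e0)" | c n where "c \<in> S" "x = f c n" using \<open>x \<in> X\<close> by (auto simp: X_def)
    then show ?thesis
    proof cases
      case 1
      then show ?thesis using e0(1) by simp
    next
      case (2 c n)
      then show ?thesis using f[of c n] by (simp add: good_def split_beta)
    qed
  qed
  have adm: "admissible S v (\<pi> w) (e w)" if "w \<in> W" for w
    unfolding \<pi>_def e_def by (rule adm_X) (simp flip: g)
  have world: "\<exists>w\<in>W. \<pi> w = r \<and> e w = d" if "(r, d) \<in> X" for r d
  proof -
    have "(r, d) \<in> range g" using that g by simp
    then obtain n where "g n = (r, d)" by (elim rangeE) simp
    then show ?thesis
      by (intro bexI[of _ "\<iota> n"]) (simp_all add: \<pi>_def e_def W_def inv_f_f[OF \<iota>])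
  qed
  have witness: "\<exists>w\<in>W. good c n (\<pi> w, e w)" if "c \<in> S" for c n
  proof -
    have "(fst (f c n), snd (f c n)) \<in> X" using that by (force simp: X_def)
    then obtain w where "w \<in> W" "\<pi> w = fst (f c n)" "e w = snd (f c n)" using world by blast
    then show ?thesis using f[OF that, of n] by (intro bexI[of _ w]) auto
  qed
  have W: "W \<noteq> {}" by (simp add: W_def)
  have model: "PiG_model W \<pi> e"
    unfolding PiG_model_def using adm W unfolding admissible_def by blast
  have valuation_range: "v a \<in> {0..1}" if "a \<in> S" for a using v that by (simp add: valuation_def)
  have pe_range: "peval (e w) v a \<in> {0..1}" if "a \<in> S" "w \<in> W" for a w
    using peval_range[OF S(1) _ _ that(1)] adm[OF that(2)] valuation_range unfolding admissible_def by blast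
  have Box: "v (Box a) = (INF w\<in>W. gimp (\<pi> w) (peval (e w) v a))" if a: "Box a \<in> S" for a
  proof (rule antisym)
    have "v (Box a) \<le> 1" using valuation_range[OF a] by simp
    then show "v (Box a) \<le> (INF w\<in>W. gimp (\<pi> w) (peval (e w) v a))"
      using W adm a by (intro cINF_greatest) (auto simp: le_gimp_iff admissible_def)
    have gr: "gimp (\<pi> w) (peval (e w) v a) \<in> {0..1}" if "w \<in> W" for w
      using gimp_range[OF pe_range[OF subformula_closedD(2)[OF S(1) a] that]] .
    have low: "(INF w\<in>W. gimp (\<pi> w) (peval (e w) v a)) \<le> gimp (\<pi> w) (peval (e w) v a)" if "w \<in> W" for w
      using gr that by (intro cINF_lower bdd_belowI[of _ 0]) auto
    show "(INF w\<in>W. gimp (\<pi> w) (peval (e w) v a)) \<le> v (Box a)"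
    proof (cases "v (Box a) < 1")
      case True
      show ?thesis
      proof (rule field_le_epsilon)
        fix \<epsilon> :: real assume "0 < \<epsilon>"
        then obtain n where n: "1 / real (Suc n) < \<epsilon>" by (metis nat_approx_posE)
        obtain w where w: "w \<in> W" "good (Box a) n (\<pi> w, e w)" using witness[OF a] by blast
        then have "gimp (\<pi> w) (peval (e w) v a) < v (Box a) + 1 / real (Suc n)"
          using True by (simp add: good_def)
        then show "(INF w\<in>W. gimp (\<pi> w) (peval (e w) v a)) \<le> v (Box a) + \<epsilon>"
          using low[OF w(1)] n by linarith
      qed
    next
      case False
      \<comment> \<open>Here \<open>v (Box a)\<close> is at least 1, which bounds every value of
        \<open>gimp\<close> in the infimum.\<close>
      then show ?thesis using W low gr by force
    qed
  qed
  have Dia: "v (Dia a) = (SUP w\<in>W. min (\<pi> w) (peval (e w) v a))" if a: "Dia a \<in> S" for a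
  proof (rule antisym)
    show "(SUP w\<in>W. min (\<pi> w) (peval (e w) v a)) \<le> v (Dia a)"
      using W adm a unfolding admissible_def by (intro cSUP_least) blast+
    have gr: "min (\<pi> w) (peval (e w) v a) \<in> {0..1}" if "w \<in> W" for w
      using pe_range[OF subformula_closedD(3)[OF S(1) a] that] adm[OF that]
      unfolding admissible_def by (auto simp: min_def)
    have up: "min (\<pi> w) (peval (e w) v a) \<le> (SUP w\<in>W. min (\<pi> w) (peval (e w) v a))" if "w \<in> W" for w
      by (rule cSUP_upper[OF that]) (use gr in \<open>intro bdd_aboveI[of _ 1], fastforce\<close>)
    show "v (Dia a) \<le> (SUP w\<in>W. min (\<pi> w) (peval (e w) v a))"
    proof (cases "0 < v (Dia a)")
      case True
      obtain w where w: "w \<in> W" "good (Dia a) 0 (\<pi> w, e w)" using witness[OF a] by blast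
      then have "v (Dia a) \<le> min (\<pi> w) (peval (e w) v a)" using True by (simp add: good_def)
      then show ?thesis using up[OF w(1)] by linarith
    next
      case False
      obtain w where w: "w \<in> W" using W by blast
      have "0 \<le> min (\<pi> w) (peval (e w) v a)" using gr[OF w] by (simp only: atLeastAtMost_iff)
      then show ?thesis using False up[OF w] by linarith
    qed
  qed
  obtain w where w: "w \<in> W" "e w = e0" using world[of 0 e0] by (auto simp: X_def)
  have ev: "eval W \<pi> e a w = 1 \<longleftrightarrow> a \<in> P" if "a \<in> S" for a
    using eval_eq_peval[OF S(1) Box Dia that w(1)] e0(2) that w(2) by simp
  have "\<forall>\<psi>\<in>T. eval W \<pi> e \<psi> w = 1" "eval W \<pi> e \<phi> w \<noteq> 1" using ev TS P(2,3) by blast+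
  then show ?thesis using model w(1) by blast
qed

text \<open>The infinite type makes room for the countable countermodel, and finiteness of
  \<open>T\<close> makes its set of subformulas finite, as the order embeddings and the choice of
  gaps require.\<close>

theorem theorem4p2:
  fixes T :: "'v::countable fm set" and \<phi> :: "'v fm"
  assumes "infinite (UNIV :: 'w set)" and "finite T"
  shows "PiG_entails TYPE('w) T \<phi> \<longleftrightarrow> T \<turnstile>\<^sub>K\<^sub>4\<^sub>5\<^sub>G \<phi>"
proof
  assume *: "PiG_entails TYPE('w) T \<phi>"
  show "T \<tturnstile> \<phi>"
  proof (rule ccontr)
    assume "\<not> T \<tturnstile> \<phi>"
    from countermodel[OF assms this] obtain W :: "'w set" and \<pi> e w
      where "PiG_model W \<pi> e" "w \<in> W" "\<forall>\<psi>\<in>T. eval W \<pi> e \<psi> w = 1" "eval W \<pi> e \<phi> w \<noteq> 1"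
      by (elim exE conjE bexE)
    then show False using * unfolding PiG_entails_def by blast
  qed
next
  assume *: "T \<tturnstile> \<phi>"
  show "PiG_entails TYPE('w) T \<phi>"
    unfolding PiG_entails_def by (intro allI impI ballI) (rule derivable_sound[OF _ *])
qed

end
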